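(* Let $k\ge 2$ be an integer and let $G$ be a $\{C_3,C_5,C_{2k},C_{2k+2}\}$-free graph with maximum degree $\Delta$. Then $\omega_2'(G)\le \max\{k\Delta,\,2k(k-1)\}$.
   Context: Graphs are finite and simple. $C_m$ denotes the cycle with $m$ vertices; a graph is $\mathcal F$-free, for a set $\mathcal F$ of graphs, if it contains no member of $\mathcal F$ as a (not necessarily induced) subgraph. A strong clique of $G$ is a set of edges of $G$ such that any two distinct edges in the set either share an endpoint or are connected by an edge of $G$ (i.e. some edge of $G$ joins an endpoint of one to an endpoint of the other). The strong clique number $\omega_2'(G)$ is the size of a largest strong clique of $G$. *)

theory Defs
  imports Main
begin

type_synonym 'a graph = "'a set \<times> 'a set set"

abbreviation verts :: "'a graph \<Rightarrow> 'a set" where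
  "verts G \<equiv> fst G"

abbreviation edges :: "'a graph \<Rightarrow> 'a set set" where
  "edges G \<equiv> snd G"

definition simple_graph :: "'a graph \<Rightarrow> bool" where
  "simple_graph G \<longleftrightarrow>
     finite (verts G) \<and> (\<forall>e\<in>edges G. e \<subseteq> verts G \<and> card e = 2)"

definition degree :: "'a graph \<Rightarrow> 'a \<Rightarrow> nat" where
  "degree G v = card {e \<in> edges G. v \<in> e}"

text \<open>The inserted \<open>0\<close> only matters for the graph without vertices.\<close>

definition max_degree :: "'a graph \<Rightarrow> nat" where
  "max_degree G = Max (insert 0 (degree G ` verts G))"

text \<open>The cycle with \<open>m\<close> vertices, meaningful for \<open>m \<ge> 3\<close>.\<close>

definition cycle_graph :: "nat \<Rightarrow> nat graph" where
  "cycle_graph m = ({..<m}, {{i, Suc i mod m} | i. i < m})"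

definition contains_subgraph :: "'a graph \<Rightarrow> 'b graph \<Rightarrow> bool" where
  "contains_subgraph G H \<longleftrightarrow>
     (\<exists>f. inj_on f (verts H) \<and> f ` verts H \<subseteq> verts G \<and> (\<forall>e\<in>edges H. f ` e \<in> edges G))"

definition graph_free :: "'b graph set \<Rightarrow> 'a graph \<Rightarrow> bool" where
  "graph_free \<F> G \<longleftrightarrow> (\<forall>H\<in>\<F>. \<not> contains_subgraph G H)"

definition strong_clique :: "'a graph \<Rightarrow> 'a set set \<Rightarrow> bool" where
  "strong_clique G S \<longleftrightarrow> S \<subseteq> edges G \<and>
     (\<forall>e\<in>S. \<forall>f\<in>S. e \<noteq> f \<longrightarrow>
        e \<inter> f \<noteq> {} \<or> (\<exists>x\<in>e. \<exists>y\<in>f. {x, y} \<in> edges G))"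

definition strong_clique_number :: "'a graph \<Rightarrow> nat" where
  "strong_clique_number G = Max {card S | S. strong_clique G S}"

lemma simple_graph_cycle_graph:
  assumes "m \<ge> 3"
  shows "simple_graph (cycle_graph m)"
proof -
  have "i \<noteq> Suc i mod m" if "i < m" for i
    using that assms by (cases "Suc i = m") auto
  then show ?thesis
    using assms by (auto simp: simple_graph_def cycle_graph_def)
qed

lemma finite_strong_clique_cards:
  assumes "simple_graph G"
  shows "finite {card S | S. strong_clique G S}" "{card S | S. strong_clique G S} \<noteq> {}"
proof -
  have "edges G \<subseteq> Pow (verts G)" "finite (verts G)"
    using assms by (auto simp: simple_graph_def)
  then have "finite (Pow (edges G))"
    by (meson finite_Pow_iff finite_subset)
  moreover have "{S. strong_clique G S} \<subseteq> Pow (edges G)"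
    by (auto simp: strong_clique_def)
  ultimately have "finite {S. strong_clique G S}"
    by (rule rev_finite_subset)
  then show "finite {card S | S. strong_clique G S}"
    by simp
  have "strong_clique G {}"
    by (simp add: strong_clique_def)
  then show "{card S | S. strong_clique G S} \<noteq> {}"
    by blast
qed

end

theory Submission
  imports Defs
begin

text \<open>
  Fix an edge \<open>ab\<close> of a strong clique \<open>S\<close>. Every edge of \<open>S\<close> can be written as \<open>xy\<close> with
  \<open>x \<sim> b\<close> or \<open>a \<sim> y\<close>, and the absence of closed walks of length 3 and 5 makes this
  orientation a bipartition in which any two oriented edges \<open>xy\<close>, \<open>x'y'\<close> satisfy \<open>x \<sim> y'\<close> or
  \<open>x' \<sim> y\<close>. A matching of \<open>k + 1\<close> oriented edges is therefore a semicomplete digraph, so it has a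
  Hamiltonian path \<open>x\<^sub>0y\<^sub>0, \<dots>, x\<^sub>ky\<^sub>k\<close> with \<open>x\<^sub>i \<sim> y\<^sub>i\<^sub>+\<^sub>1\<close>. If \<open>x\<^sub>0 \<sim> y\<^sub>k\<close> this closes up to a
  \<open>C\<^sub>2\<^sub>k\<close>, and if \<open>x\<^sub>k \<sim> y\<^sub>0\<close> to a \<open>C\<^sub>2\<^sub>k\<^sub>+\<^sub>2\<close>. Hence there is no such matching, and by Koenig's
  theorem \<open>k\<close> vertices cover all edges of \<open>S\<close>, which gives at most \<open>k\<Delta>\<close> edges.
\<close>

section \<open>Koenig's theorem for bipartite relations\<close>

text \<open>The two sides are covered separately because their types may coincide. Finiteness is
  demanded since \<open>card\<close> of an infinite set is 0, so an infinite cover would count as an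
  empty one.\<close>

definition covers :: "'a set \<Rightarrow> 'b set \<Rightarrow> ('a \<times> 'b) set \<Rightarrow> bool" where
  "covers C D R \<longleftrightarrow> finite C \<and> finite D \<and> (\<forall>(x, y)\<in>R. x \<in> C \<or> y \<in> D)"

lemma covers_converse: "covers D C (R\<inverse>) \<longleftrightarrow> covers C D R"
  by (auto simp: covers_def)

text \<open>Uncrossing the covers of \<open>R - {(x, y\<^sub>1)}\<close> and \<open>R - {(x, y\<^sub>2)}\<close> yields two covers, of \<open>R\<close> and
  of \<open>R - {(x, y\<^sub>1), (x, y\<^sub>2)}\<close>, of the same total size.\<close>

lemma cover_critical_inj_fst:
  assumes low: "\<And>C D. covers C D R \<Longrightarrow> t \<le> card C + card D"
    and crit: "\<And>e. e \<in> R \<Longrightarrow> \<exists>C D. covers C D (R - {e}) \<and> card C + card D < t"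
  shows "inj_on fst R"
proof (rule inj_onI, rule ccontr)
  fix e\<^sub>1 e\<^sub>2 assume e: "e\<^sub>1 \<in> R" "e\<^sub>2 \<in> R" "fst e\<^sub>1 = fst e\<^sub>2" "e\<^sub>1 \<noteq> e\<^sub>2"
  obtain x y\<^sub>1 y\<^sub>2 where xy: "e\<^sub>1 = (x, y\<^sub>1)" "e\<^sub>2 = (x, y\<^sub>2)" "y\<^sub>1 \<noteq> y\<^sub>2"
    using e by (metis prod.collapse)
  obtain C\<^sub>1 D\<^sub>1 where 1: "covers C\<^sub>1 D\<^sub>1 (R - {e\<^sub>1})" "card C\<^sub>1 + card D\<^sub>1 < t"
    using crit e by blast
  obtain C\<^sub>2 D\<^sub>2 where 2: "covers C\<^sub>2 D\<^sub>2 (R - {e\<^sub>2})" "card C\<^sub>2 + card D\<^sub>2 < t"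
    using crit e by blast
  have fin: "finite C\<^sub>1" "finite D\<^sub>1" "finite C\<^sub>2" "finite D\<^sub>2"
    using 1 2 by (auto simp: covers_def)
  have "\<not> covers C\<^sub>1 D\<^sub>1 R" "\<not> covers C\<^sub>2 D\<^sub>2 R"
    using low 1 2 by (meson not_le)+
  \<comment> \<open>If \<open>x\<close> were in one of these sets, that cover would also cover the
    deleted pair, hence all of \<open>R\<close>.\<close>
  then have "x \<notin> C\<^sub>1" "x \<notin> C\<^sub>2"
    using 1 2 unfolding covers_def xy by auto
  then have y: "y\<^sub>2 \<in> D\<^sub>1" "y\<^sub>1 \<in> D\<^sub>2"
    using 1 2 e(1,2) xy(3) unfolding covers_def xy by auto
  have "covers (C\<^sub>1 \<inter> C\<^sub>2) (D\<^sub>1 \<union> D\<^sub>2) R"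
    using 1 2 y unfolding covers_def xy by fastforce
  then have A: "t \<le> card (C\<^sub>1 \<inter> C\<^sub>2) + card (D\<^sub>1 \<union> D\<^sub>2)"
    by (rule low)
  have "covers (insert x (C\<^sub>1 \<union> C\<^sub>2)) (D\<^sub>1 \<inter> D\<^sub>2) R"
    using 1 2 unfolding covers_def xy by fastforce
  then have "t \<le> card (insert x (C\<^sub>1 \<union> C\<^sub>2)) + card (D\<^sub>1 \<inter> D\<^sub>2)"
    by (rule low)
  also have "\<dots> \<le> Suc (card (C\<^sub>1 \<union> C\<^sub>2)) + card (D\<^sub>1 \<inter> D\<^sub>2)"
    using fin by (simp add: card_insert_if)
  finally show False
    \<comment> \<open>Adding the two lower bounds gives 2t on the left, while uncrossing bounds the
      right side by the two given sizes plus 1, so by 2(t - 1) + 1.\<close>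
    using A 1 2 card_Un_Int[of C\<^sub>1 C\<^sub>2] card_Un_Int[of D\<^sub>1 D\<^sub>2] fin by linarith
qed

text \<open>Pairs are deleted as long as no cover smaller than \<open>t\<close> appears. Once every
  deletion would create one, uncrossing, applied to \<open>R\<close> and to its converse, shows that
  what remains is a matching.\<close>

theorem Koenig:
  assumes "finite R"
    and "\<And>C D. covers C D R \<Longrightarrow> t \<le> card C + card D"
  shows "\<exists>M\<subseteq>R. inj_on fst M \<and> inj_on snd M \<and> t \<le> card M"
  using assms
proof (induction rule: finite_psubset_induct)
  case (psubset R)
  show ?case
  proof (cases "\<exists>e\<in>R. \<forall>C D. covers C D (R - {e}) \<longrightarrow> t \<le> card C + card D")
    case True
    then obtain e where "e \<in> R" "\<And>C D. covers C D (R - {e}) \<Longrightarrow> t \<le> card C + card D"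
      by blast
    then show ?thesis
      using psubset.IH[of "R - {e}"] by blast
  next
    case False
    then have crit: "\<exists>C D. covers C D (R - {e}) \<and> card C + card D < t" if "e \<in> R" for e
      using that by (meson not_le)
    have fst: "inj_on fst R"
      using psubset.prems crit by (rule cover_critical_inj_fst)
    have "inj_on fst (R\<inverse>)"
    proof (rule cover_critical_inj_fst)
      show "t \<le> card C + card D" if "covers C D (R\<inverse>)" for C D
        using psubset.prems that by (metis add.commute covers_converse)
      fix e assume "e \<in> R\<inverse>"
      then obtain C D where "covers C D (R - {prod.swap e})" "card C + card D < t"
        using crit[of "prod.swap e"] by auto
      moreover have "(R - {prod.swap e})\<inverse> = R\<inverse> - {e}"
        by (cases e) auto
      ultimately show "\<exists>C D. covers C D (R\<inverse> - {e}) \<and> card C + card D < t"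
        by (metis add.commute covers_converse)
    qed
    then have snd: "inj_on snd R"
      by (fastforce simp: inj_on_def Ball_def)
    \<comment> \<open>The first endpoints alone form a cover, and a matching has as many of them as
      pairs.\<close>
    have "covers (fst ` R) {} R"
      using psubset.hyps by (force simp: covers_def)
    then have "t \<le> card R"
      using psubset.prems card_image[OF fst] by fastforce
    with fst snd show ?thesis
      by blast
  qed
qed

section \<open>Hamiltonian paths in semicomplete digraphs\<close>

text \<open>The new vertex goes right before the first \<open>u\<close> with \<open>P v u\<close>,
  or to the end if there is none; every vertex passed over has an arc to \<open>v\<close>.\<close>

lemma successively_insert_vertex:
  assumes "successively P xs" "\<And>u. u \<in> set xs \<Longrightarrow> P u v \<or> P v u"
  shows "\<exists>ys zs. xs = ys @ zs \<and> successively P (ys @ v # zs)"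
  using assms
proof (induction xs)
  case Nil
  then show ?case by auto
next
  case (Cons x xs)
  show ?case
  proof (cases "P v x")
    case True
    then show ?thesis
      using Cons.prems by (intro exI[of _ "[]"] exI[of _ "x # xs"]) auto
  next
    case False
    then have "P x v"
      using Cons.prems by auto
    obtain ys zs where "xs = ys @ zs" "successively P (ys @ v # zs)"
      using Cons by (auto simp: successively_Cons)
    then show ?thesis
      using Cons.prems \<open>P x v\<close>
      by (intro exI[of _ "x # ys"] exI[of _ zs]) (cases ys; auto simp: successively_Cons)
  qed
qed

lemma semicomplete_Hamiltonian_path:
  assumes "finite M" "\<And>u v. u \<in> M \<Longrightarrow> v \<in> M \<Longrightarrow> P u v \<or> P v u"
  shows "\<exists>xs. distinct xs \<and> set xs = M \<and> successively P xs"
  using assms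
proof (induction rule: finite_induct)
  case empty
  then show ?case by simp
next
  case (insert v M)
  then obtain xs where xs: "distinct xs" "set xs = M" "successively P xs"
    by auto
  obtain ys zs where "xs = ys @ zs" "successively P (ys @ v # zs)"
    using successively_insert_vertex[of P xs v] xs insert.prems by blast
  then show ?case
    using xs insert.hyps by (intro exI[of _ "ys @ v # zs"]) auto
qed

section \<open>Cycles and short closed walks\<close>

text \<open>The closing edge is split off so that applications never meet
  \<open>mod\<close>.\<close>

lemma contains_cycle_graphI:
  assumes G: "simple_graph G" and inj: "inj_on f {..<m}"
    and step: "\<And>i. Suc i < m \<Longrightarrow> {f i, f (Suc i)} \<in> edges G"
    and close: "{f (m - 1), f 0} \<in> edges G"
  shows "contains_subgraph G (cycle_graph m)"
proof -
  have E: "{f i, f (Suc i mod m)} \<in> edges G" if "i < m" for i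
    using that step[of i] close by (cases "Suc i = m") auto
  moreover have "f i \<in> verts G" if "i < m" for i
    using E[OF that] G by (auto simp: simple_graph_def)
  ultimately show ?thesis
    using inj unfolding contains_subgraph_def cycle_graph_def by (intro exI[of _ f]) auto
qed

lemma edge_irrefl:
  assumes "simple_graph G"
  shows "{x, x} \<notin> edges G"
  using assms by (auto simp: simple_graph_def)

lemma no_closed_3_walk:
  assumes G: "simple_graph G" and free: "\<not> contains_subgraph G (cycle_graph 3)"
    and E: "{a, b} \<in> edges G" "{b, c} \<in> edges G" "{c, a} \<in> edges G"
  shows False
proof -
  have "a \<noteq> b" "b \<noteq> c" "c \<noteq> a"
    using E edge_irrefl[OF G] by blast+
  then have "inj_on (\<lambda>i. [a, b, c] ! i) {..<3}"
    by (intro inj_on_nth) auto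
  moreover have "{[a, b, c] ! i, [a, b, c] ! Suc i} \<in> edges G" if "Suc i < 3" for i
  proof -
    from that have "i = 0 \<or> i = 1" by linarith
    then show ?thesis using E by auto
  qed
  ultimately show False
    using free contains_cycle_graphI[OF G, of "\<lambda>i. [a, b, c] ! i" 3] E by simp
qed

text \<open>If two non-consecutive vertices of the walk coincide, it splits into an edge traversed
  back and forth and a closed walk of length 3. Otherwise it is a genuine 5-cycle.\<close>

lemma no_closed_5_walk:
  assumes G: "simple_graph G" and free3: "\<not> contains_subgraph G (cycle_graph 3)"
    and free: "\<not> contains_subgraph G (cycle_graph 5)"
    and E: "{a, b} \<in> edges G" "{b, c} \<in> edges G" "{c, d} \<in> edges G" "{d, e} \<in> edges G"
      "{e, a} \<in> edges G"
  shows False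
proof -
  note tri = no_closed_3_walk[OF G free3]
  have "a \<noteq> b" "b \<noteq> c" "c \<noteq> d" "d \<noteq> e" "e \<noteq> a"
    using E edge_irrefl[OF G] by blast+
  moreover have "a \<noteq> c" using tri[of c d e] E by auto
  moreover have "a \<noteq> d" using tri[of a b c] E by auto
  moreover have "b \<noteq> d" using tri[of a b e] E by (auto simp: insert_commute)
  moreover have "b \<noteq> e" using tri[of b c d] E by auto
  moreover have "c \<noteq> e" using tri[of a b c] E by (auto simp: insert_commute)
  ultimately have "inj_on (\<lambda>i. [a, b, c, d, e] ! i) {..<5}"
    by (intro inj_on_nth) auto
  moreover have "{[a, b, c, d, e] ! i, [a, b, c, d, e] ! Suc i} \<in> edges G" if "Suc i < 5" for i
  proof -
    from that have "i = 0 \<or> i = 1 \<or> i = 2 \<or> i = 3" by linarith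
    then show ?thesis using E by auto
  qed
  ultimately show False
    using free contains_cycle_graphI[OF G, of "\<lambda>i. [a, b, c, d, e] ! i" 5] E by simp
qed

section \<open>Orienting a strong clique\<close>

lemma strong_clique_orientation:
  assumes G: "simple_graph G"
    and free: "\<not> contains_subgraph G (cycle_graph 3)" "\<not> contains_subgraph G (cycle_graph 5)"
    and S: "strong_clique G S"
  obtains R where "S = (\<lambda>(x, y). {x, y}) ` R"
    and "\<And>x y x' y'. (x, y) \<in> R \<Longrightarrow> (x', y') \<in> R \<Longrightarrow> x \<noteq> y'"
    and "\<And>x y x' y'. (x, y) \<in> R \<Longrightarrow> (x', y') \<in> R \<Longrightarrow> {x, y'} \<in> edges G \<or> {x', y} \<in> edges G"
proof (cases "S = {}")
  case True
  then show ?thesis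
    by (intro that[of "{}"]) auto
next
  case False
  define adj where "adj x y \<longleftrightarrow> {x, y} \<in> edges G" for x y
  have sym: "adj y x" if "adj x y" for x y
    using that by (simp add: adj_def insert_commute)
  have w3: False if "adj x y" "adj y z" "adj z x" for x y z
    using no_closed_3_walk[OF G free(1)] that unfolding adj_def by blast
  have w5: False if "adj x y" "adj y z" "adj z u" "adj u v" "adj v x" for x y z u v
    using no_closed_5_walk[OF G free] that unfolding adj_def by blast
  have pair: "\<exists>x y. e = {x, y}" if "e \<in> S" for e
    using that S G unfolding strong_clique_def simple_graph_def by (meson card_2_iff subsetD)
  have S_adj: "adj x y" if "{x, y} \<in> S" for x y
    using that S by (auto simp: strong_clique_def adj_def)
  \<comment> \<open>A shared endpoint, in particular equality of the two edges, yields such an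
    adjacency through one of the edges themselves.\<close>
  have link: "adj x x' \<or> adj x y' \<or> adj y x' \<or> adj y y'"
    if "{x, y} \<in> S" "{x', y'} \<in> S" for x y x' y'
  proof (cases "{x, y} \<inter> {x', y'} = {}")
    case True
    then have "\<exists>u\<in>{x, y}. \<exists>v\<in>{x', y'}. {u, v} \<in> edges G"
      using S that unfolding strong_clique_def by blast
    then show ?thesis by (auto simp: adj_def)
  next
    case False
    then show ?thesis using S_adj[OF that(1)] S_adj[OF that(2)] sym by auto
  qed
  obtain a b where ab: "{a, b} \<in> S"
    using False pair by blast
  have adj_ab: "adj a b" using ab by (rule S_adj)
  define R where "R = {(x, y). {x, y} \<in> S \<and> (adj x b \<or> adj a y)}"
  have RS: "adj x y" "{x, y} \<in> S" "adj x b \<or> adj a y" if "(x, y) \<in> R" for x y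
    using that S_adj by (auto simp: R_def)
  have img: "S = (\<lambda>(x, y). {x, y}) ` R"
  proof
    show "S \<subseteq> (\<lambda>(x, y). {x, y}) ` R"
    proof
      fix e assume e: "e \<in> S"
      then obtain x y where xy: "e = {x, y}"
        using pair by blast
      then have "(x, y) \<in> R \<or> (y, x) \<in> R"
        using link[of x y a b] e ab sym by (auto simp: R_def insert_commute)
      then show "e \<in> (\<lambda>(x, y). {x, y}) ` R"
        using xy by (force simp: insert_commute)
    qed
  qed (auto simp: R_def)
  \<comment> \<open>Here and in the next two facts, each pair attaches to \<open>ab\<close> in one
    of two ways; each of the four combinations closes a walk of length 3 or 5.\<close>
  have sides: "x \<noteq> y'" if "(x, y) \<in> R" "(x', y') \<in> R" for x y x' y'
    using RS[OF that(1)] RS[OF that(2)] adj_ab w3[of x x' b] w3[of a b x] w3[of a x y]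
      w5[of x y a b x'] sym by blast
  have no_left: "\<not> adj x x'" if "(x, y) \<in> R" "(x', y') \<in> R" for x y x' y'
    using RS[OF that(1)] RS[OF that(2)] adj_ab w3[of x x' b] w5[of x x' y' a b]
      w5[of x' x y a b] w5[of x x' y' a y] sym by blast
  have no_right: "\<not> adj y y'" if "(x, y) \<in> R" "(x', y') \<in> R" for x y x' y'
    using RS[OF that(1)] RS[OF that(2)] adj_ab w3[of y y' a] w5[of y y' x' b a]
      w5[of y' y x b a] w5[of y y' x' b x] sym by blast
  have "adj x y' \<or> adj x' y" if "(x, y) \<in> R" "(x', y') \<in> R" for x y x' y'
    using link[OF RS(2)[OF that(1)] RS(2)[OF that(2)]] no_left[OF that] no_right[OF that] sym
    by blast
  with img sides show ?thesis
    unfolding adj_def by (intro that[of R]) blast+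
qed

section \<open>Closing a path of matching edges\<close>

lemma path_of_edges_closes_to_cycle:
  fixes p :: "nat \<Rightarrow> 'a \<times> 'a"
  assumes G: "simple_graph G" and k: "k \<ge> 1"
    and inj: "inj_on (\<lambda>i. fst (p i)) {..k}" "inj_on (\<lambda>i. snd (p i)) {..k}"
    and disj: "\<And>i j. i \<le> k \<Longrightarrow> j \<le> k \<Longrightarrow> fst (p i) \<noteq> snd (p j)"
    and match: "\<And>i. i \<le> k \<Longrightarrow> {fst (p i), snd (p i)} \<in> edges G"
    and path: "\<And>i. i < k \<Longrightarrow> {fst (p i), snd (p (Suc i))} \<in> edges G"
  shows "{fst (p 0), snd (p k)} \<in> edges G \<Longrightarrow> contains_subgraph G (cycle_graph (2 * k))"
    and "{fst (p k), snd (p 0)} \<in> edges G \<Longrightarrow> contains_subgraph G (cycle_graph (2 * k + 2))"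
proof -
  have parity: thesis if "\<And>n. i = 2 * n \<Longrightarrow> thesis" "\<And>n. i = Suc (2 * n) \<Longrightarrow> thesis"
    for i :: nat and thesis
    using that by (metis evenE oddE Suc_eq_plus1)
  have disj': "snd (p j) \<noteq> fst (p i)" if "i \<le> k" "j \<le> k" for i j
    using disj[OF that] by simp
  have inj_iff: "fst (p i) = fst (p j) \<longleftrightarrow> i = j" "snd (p i) = snd (p j) \<longleftrightarrow> i = j"
    if "i \<le> k" "j \<le> k" for i j
    using that inj by (auto dest: inj_onD)
  show "contains_subgraph G (cycle_graph (2 * k))" if close: "{fst (p 0), snd (p k)} \<in> edges G"
  proof (rule contains_cycle_graphI[OF G])
    \<comment> \<open>With \<open>p i\<close> = (x_i, y_i), the cycle is x_0 y_1 x_1 y_2 ... x_(k-1)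
      y_k, leaving out y_0 and x_k.\<close>
    let ?f = "\<lambda>j. if even j then fst (p (j div 2)) else snd (p (Suc (j div 2)))"
    show "inj_on ?f {..<2 * k}"
    proof (rule inj_onI)
      fix i j assume "i \<in> {..<2 * k}" "j \<in> {..<2 * k}" "?f i = ?f j"
      then show "i = j"
        by (cases i rule: parity; cases j rule: parity) (auto simp: inj_iff disj disj')
    qed
    show "{?f i, ?f (Suc i)} \<in> edges G" if "Suc i < 2 * k" for i
      using that match path by (cases i rule: parity) (auto simp: insert_commute)
    \<comment> \<open>This makes the last index 2k - 1 visibly odd, so that its vertex evaluates to
      y_k.\<close>
    obtain n where "k = Suc n" using k by (cases k) auto
    then show "{?f (2 * k - 1), ?f 0} \<in> edges G"
      using close by (simp add: insert_commute)
  qed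
  show "contains_subgraph G (cycle_graph (2 * k + 2))" if close: "{fst (p k), snd (p 0)} \<in> edges G"
  proof (rule contains_cycle_graphI[OF G])
    \<comment> \<open>Now all endpoints are used, in the order y_0 x_0 y_1 x_1 ... y_k x_k.\<close>
    let ?f = "\<lambda>j. if even j then snd (p (j div 2)) else fst (p (j div 2))"
    show "inj_on ?f {..<2 * k + 2}"
    proof (rule inj_onI)
      fix i j assume "i \<in> {..<2 * k + 2}" "j \<in> {..<2 * k + 2}" "?f i = ?f j"
      then show "i = j"
        by (cases i rule: parity; cases j rule: parity) (auto simp: inj_iff disj disj')
    qed
    show "{?f i, ?f (Suc i)} \<in> edges G" if "Suc i < 2 * k + 2" for i
      using that match path by (cases i rule: parity) (auto simp: insert_commute)
    show "{?f (2 * k + 2 - 1), ?f 0} \<in> edges G"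
      using close by simp
  qed
qed

section \<open>Counting the edges of a strong clique\<close>

text \<open>All \<open>v\<close> are allowed because a cover may contain elements that are not
  vertices of \<open>G\<close>; these have degree 0.\<close>

lemma degree_le_max_degree:
  assumes G: "simple_graph G"
  shows "degree G v \<le> max_degree G"
proof (cases "v \<in> verts G")
  case True
  then show ?thesis
    using G by (auto simp: max_degree_def simple_graph_def intro: Max_ge)
next
  case False
  then have "{e \<in> edges G. v \<in> e} = {}"
    using G by (auto simp: simple_graph_def)
  then show ?thesis
    by (metis card.empty degree_def le0)
qed

lemma finite_edges: "simple_graph G \<Longrightarrow> finite (edges G)"
  by (rule finite_subset[of _ "Pow (verts G)"]) (auto simp: simple_graph_def)

lemma covers_card_le:
  assumes G: "simple_graph G" and S: "(\<lambda>(x, y). {x, y}) ` R \<subseteq> edges G" and C: "covers C D R"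
  shows "card ((\<lambda>(x, y). {x, y}) ` R) \<le> (card C + card D) * max_degree G"
proof -
  have fin: "finite C" "finite D" using C by (auto simp: covers_def)
  let ?E = "\<lambda>v. {e \<in> edges G. v \<in> e}"
  have "(\<lambda>(x, y). {x, y}) ` R \<subseteq> (\<Union>v\<in>C \<union> D. ?E v)"
    using S C by (fastforce simp: covers_def)
  then have "card ((\<lambda>(x, y). {x, y}) ` R) \<le> card (\<Union>v\<in>C \<union> D. ?E v)"
    using fin finite_edges[OF G] by (intro card_mono) auto
  also have "\<dots> \<le> (\<Sum>v\<in>C \<union> D. degree G v)"
    unfolding degree_def using fin by (intro card_UN_le) auto
  also have "\<dots> \<le> card (C \<union> D) * max_degree G"
    using sum_bounded_above[of "C \<union> D" "degree G" "max_degree G"] degree_le_max_degree[OF G]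
    by simp
  also have "\<dots> \<le> (card C + card D) * max_degree G"
    by (intro mult_right_mono card_Un_le) simp
  finally show ?thesis .
qed

lemma strong_clique_card_le:
  assumes k: "k \<ge> 1" and G: "simple_graph G"
    and free: "\<not> contains_subgraph G (cycle_graph 3)" "\<not> contains_subgraph G (cycle_graph 5)"
      "\<not> contains_subgraph G (cycle_graph (2 * k))" "\<not> contains_subgraph G (cycle_graph (2 * k + 2))"
    and S: "strong_clique G S"
  shows "card S \<le> k * max_degree G"
proof -
  obtain R where img: "S = (\<lambda>(x, y). {x, y}) ` R"
    and sides: "\<And>x y x' y'. (x, y) \<in> R \<Longrightarrow> (x', y') \<in> R \<Longrightarrow> x \<noteq> y'"
    and link: "\<And>x y x' y'. (x, y) \<in> R \<Longrightarrow> (x', y') \<in> R \<Longrightarrow>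
                 {x, y'} \<in> edges G \<or> {x', y} \<in> edges G"
    using strong_clique_orientation[OF G free(1,2) S] by blast
  have SE: "S \<subseteq> edges G" using S by (simp add: strong_clique_def)
  have "R \<subseteq> verts G \<times> verts G"
    using SE G unfolding img simple_graph_def by fastforce
  then have finR: "finite R"
    using G by (auto simp: simple_graph_def intro: finite_subset)
  have "\<not> (\<forall>C D. covers C D R \<longrightarrow> Suc k \<le> card C + card D)"
  proof
    assume "\<forall>C D. covers C D R \<longrightarrow> Suc k \<le> card C + card D"
    then obtain M' where M': "M' \<subseteq> R" "inj_on fst M'" "inj_on snd M'" "Suc k \<le> card M'"
      using Koenig[OF finR, of "Suc k"] by blast
    \<comment> \<open>The matching is cut down to exactly k + 1 edges because its size determines
      the lengths of the cycles.\<close>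
    obtain M where M: "M \<subseteq> M'" "card M = Suc k" "finite M"
      using M'(4) by (rule obtain_subset_with_card_n)
    define P where "P u v \<longleftrightarrow> {fst u, snd v} \<in> edges G" for u v :: "'a \<times> 'a"
    have semi: "P u v \<or> P v u" if "u \<in> R" "v \<in> R" for u v
      using link[of "fst u" "snd u" "fst v" "snd v"] that by (simp add: P_def)
    obtain xs where xs: "distinct xs" "set xs = M" "successively P xs"
      using semicomplete_Hamiltonian_path[OF M(3), of P] semi M(1) M'(1) by blast
    have len: "length xs = Suc k"
      using xs M(2) distinct_card by metis
    have inR: "xs ! i \<in> M" "xs ! i \<in> M'" "xs ! i \<in> R" if "i \<le> k" for i
      using that xs len M(1) M'(1) by (metis le_imp_less_Suc nth_mem subsetD)+
    have inj: "inj_on (\<lambda>i. fst (xs ! i)) {..k}" "inj_on (\<lambda>i. snd (xs ! i)) {..k}"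
      using inR(2) M'(2,3) xs(1) len
      by (auto simp: inj_on_def nth_eq_iff_index_eq[symmetric])
    have disj: "fst (xs ! i) \<noteq> snd (xs ! j)" if "i \<le> k" "j \<le> k" for i j
      using sides inR(3) that by (metis prod.collapse)
    \<comment> \<open>For equal arguments both alternatives of \<open>semi\<close> say that the pair
      itself is an edge.\<close>
    have match: "{fst (xs ! i), snd (xs ! i)} \<in> edges G" if "i \<le> k" for i
      using semi[of "xs ! i" "xs ! i"] inR(3)[OF that] by (simp add: P_def)
    have path: "{fst (xs ! i), snd (xs ! Suc i)} \<in> edges G" if "i < k" for i
      using xs(3) len that by (auto simp: successively_conv_nth P_def)
    \<comment> \<open>Comparing the two ends of the path yields one of the two closing edges, hence
      a forbidden cycle.\<close>
    have "P (xs ! 0) (xs ! k) \<or> P (xs ! k) (xs ! 0)"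
      using semi inR(3) by simp
    then show False
      using path_of_edges_closes_to_cycle[OF G k inj disj match path] free(3,4)
      by (auto simp: P_def)
  qed
  then obtain C D where C: "covers C D R" "card C + card D \<le> k"
    by (meson not_less_eq_eq)
  have "card S \<le> (card C + card D) * max_degree G"
    using covers_card_le[OF G _ C(1)] SE img by simp
  also have "\<dots> \<le> k * max_degree G"
    using C(2) by (rule mult_le_mono1)
  finally show ?thesis .
qed

theorem theorem10:
  fixes G :: "'a graph" and k \<Delta> :: nat
  assumes "k \<ge> 2"
    and "simple_graph G"
    and "graph_free {cycle_graph 3, cycle_graph 5, cycle_graph (2 * k), cycle_graph (2 * k + 2)} G"
    and "max_degree G = \<Delta>"
  shows "strong_clique_number G \<le> max (k * \<Delta>) (2 * k * (k - 1))"
proof -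
  have "card S \<le> k * \<Delta>" if "strong_clique G S" for S
    using strong_clique_card_le[of k G S] assms that by (simp add: graph_free_def)
  then have "strong_clique_number G \<le> k * \<Delta>"
    unfolding strong_clique_number_def using finite_strong_clique_cards[OF assms(2)]
    by (subst Max_le_iff) auto
  then show ?thesis
    by simp
qed

end
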